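(* Suppose $n\in\mathbb{N}$. (1) Then $Z_0(K_n\,\Box\,K_2)=Z_1(K_n\,\Box\,K_2)=\cdots=Z(K_n\,\Box\,K_2)=n$. (2) For any $n\ge 3$, $Z_0(P_n\,\Box\,K_2)=Z_1(P_n\,\Box\,K_2)=\cdots=Z(P_n\,\Box\,K_2)=2$. (3) For any $n\ge 3$, $Z_0(C_n\,\Box\,K_2)=Z_1(C_n\,\Box\,K_2)=\cdots=Z(C_n\,\Box\,K_2)=4$.
   Context: $\Box$ denotes the Cartesian product of graphs; $K_n$, $P_n$, $C_n$ are the complete graph, path and cycle on $n$ vertices. Colour change rule (CCR): if a coloured vertex has exactly one uncoloured neighbour, that neighbour becomes coloured. $Z_q$-game ($q\ge 0$ an integer): initially all vertices of $G=(V,E)$ are uncoloured. The player repeatedly applies one of the following until all vertices are coloured: (1) for one token, colour any uncoloured vertex; (2) at no cost, apply the CCR on $G$; (3) if $B$ is the current set of coloured vertices and $W_1,\dots,W_k$ are the vertex sets of the connected components of the induced subgraph $G[V\setminus B]$ with $k\ge q+1$, the player selects at least $q+1$ of the $W_i$'s and announces them to an oracle, the oracle returns a nonempty subset $\{W_{i_1},\dots,W_{i_\ell}\}$ of the selected ones, and at no cost the player can apply the CCR on $G[B\cup W_{i_1}\cup\cdots\cup W_{i_\ell}]$. $Z_q(G)$ is the minimum number of tokens needed to guarantee that all vertices can be coloured regardless of how the oracle responds. $Z(G)$, the zero forcing number, is the analogous minimum when only operations (1) and (2) are allowed. One has $Z_0(G)\le Z_1(G)\le\cdots\le Z(G)$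.
   Formalization: Part (3) is stated for n ≥ 4 instead of n ≥ 3: at n = 3 it is false, since C_3 = K_3 and colouring one triangle of C_3 □ K_2 forces the other, so the value there is 3, as part (1) says. *)

theory Defs
  imports "Graph_Theory.Graph_Theory"
begin

text \<open>
  As in \<^theory>\<open>Graph_Theory.Kuratowski\<close>, a finite simple graph is represented by a finite,
  symmetric, loop-free digraph. For such digraphs the strongly connected components are the
  connected components, so \<^const>\<open>pre_digraph.sccs_verts\<close> yields the vertex sets of the
  connected components.
\<close>

subsection \<open>The graphs\<close>

definition complete_graph :: "nat \<Rightarrow> nat pair_pre_digraph" where
  "complete_graph n =
    \<lparr> pverts = {..<n}, parcs = {(u, v). u < n \<and> v < n \<and> u \<noteq> v} \<rparr>"

definition path_graph :: "nat \<Rightarrow> nat pair_pre_digraph" where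
  "path_graph n =
    \<lparr> pverts = {..<n}, parcs = {(u, v). u < n \<and> v < n \<and> (v = Suc u \<or> u = Suc v)} \<rparr>"

text \<open>Only meant for \<open>n \<ge> 3\<close>; for \<open>n = 1\<close> the definition produces a loop.\<close>

definition cycle_graph :: "nat \<Rightarrow> nat pair_pre_digraph" where
  "cycle_graph n =
    \<lparr> pverts = {..<n},
      parcs = {(u, v). u < n \<and> v < n \<and> (v = Suc u mod n \<or> u = Suc v mod n)} \<rparr>"

definition box_product ::
  "'a pair_pre_digraph \<Rightarrow> 'b pair_pre_digraph \<Rightarrow> ('a \<times> 'b) pair_pre_digraph"
  (infixl \<open>\<box>\<close> 70) where
  "G \<box> H =
    \<lparr> pverts = pverts G \<times> pverts H,
      parcs = {((u, x), (v, y)).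
        (u = v \<and> u \<in> pverts G \<and> (x, y) \<in> parcs H) \<or>
        ((u, v) \<in> parcs G \<and> x = y \<and> x \<in> pverts H)} \<rparr>"

lemma complete_digraph_complete_graph: "complete_digraph n (with_proj (complete_graph n))"
  by (auto simp: complete_digraph_pair_def complete_graph_def)

lemma pair_graph_path_graph: "pair_graph (path_graph n)"
proof -
  have "finite (parcs (path_graph n))"
    by (rule finite_subset[of _ "{..<n} \<times> {..<n}"]) (auto simp: path_graph_def)
  moreover have "sym (parcs (path_graph n))"
    by (rule symI) (auto simp: path_graph_def)
  ultimately show ?thesis
    by unfold_locales (auto simp: path_graph_def symmetric_def)
qed

lemma pair_graph_cycle_graph:
  assumes "n \<ge> 2"
  shows "pair_graph (cycle_graph n)"
proof -
  have "finite (parcs (cycle_graph n))"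
    by (rule finite_subset[of _ "{..<n} \<times> {..<n}"]) (auto simp: cycle_graph_def)
  moreover have "fst e \<noteq> snd e" if "e \<in> parcs (cycle_graph n)" for e
  proof -
    have "Suc u mod n \<noteq> u" if "u < n" for u
      using that assms by (cases "Suc u = n") auto
    then show ?thesis
      using that by (force simp: cycle_graph_def)
  qed
  moreover have "sym (parcs (cycle_graph n))"
    by (rule symI) (auto simp: cycle_graph_def)
  moreover have "parcs (cycle_graph n) \<subseteq> {..<n} \<times> {..<n}" "pverts (cycle_graph n) = {..<n}"
    by (auto simp: cycle_graph_def)
  ultimately show ?thesis
    by unfold_locales (auto simp: symmetric_def)
qed

lemma pair_graph_box_product:
  assumes "pair_graph G" "pair_graph H"
  shows "pair_graph (G \<box> H)"
proof -
  interpret G: pair_graph G by fact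
  interpret H: pair_graph H by fact
  let ?V = "pverts G \<times> pverts H"
  have sub: "parcs (G \<box> H) \<subseteq> ?V \<times> ?V"
    by (auto simp: box_product_def dest: G.in_arcsD1 G.in_arcsD2 H.in_arcsD1 H.in_arcsD2)
  moreover have fin: "finite ?V"
    using G.pair_finite_verts H.pair_finite_verts by blast
  ultimately have "finite (parcs (G \<box> H))"
    by (meson finite_SigmaI finite_subset)
  moreover have "sym (parcs (G \<box> H))"
    using G.pair_sym_arcs H.pair_sym_arcs
    by (auto simp: box_product_def symmetric_def sym_def)
  moreover have "fst e \<noteq> snd e" if "e \<in> parcs (G \<box> H)" for e
    using that G.pair_no_loops H.pair_no_loops by (fastforce simp: box_product_def)
  moreover have "pverts (G \<box> H) = ?V"
    by (simp add: box_product_def)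
  ultimately show ?thesis
    using sub fin by unfold_locales (auto simp: symmetric_def)
qed

text \<open>
  The \<open>3\<close>-cycle is complete, so for \<open>n = 3\<close> the graphs \<open>C\<^sub>n \<box> K\<^sub>2\<close> and \<open>K\<^sub>n \<box> K\<^sub>2\<close> coincide,
  and a common value \<open>4\<close> for the former, \<open>n\<close> for the latter is possible only from \<open>n = 4\<close> on.
\<close>

lemma cycle_graph_3: "cycle_graph 3 = complete_graph 3"
proof -
  have *: "(v = Suc u mod 3 \<or> u = Suc v mod 3) \<longleftrightarrow> u \<noteq> v" if "u < 3" "v < 3" for u v :: nat
  proof -
    consider "u = 0" | "u = 1" | "u = 2" using \<open>u < 3\<close> by linarith
    then show ?thesis
      using \<open>v < 3\<close> by cases (simp_all, presburger+)
  qed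
  have "u < 3 \<and> v < 3 \<and> (v = Suc u mod 3 \<or> u = Suc v mod 3) \<longleftrightarrow> u < 3 \<and> v < 3 \<and> u \<noteq> v"
    for u v :: nat
    using *[of u v] by argo
  then show ?thesis
    by (simp only: cycle_graph_def complete_graph_def)
qed


subsection \<open>The colour change rule and the forcing games\<close>

definition ccr :: "('a, 'b) pre_digraph \<Rightarrow> 'a set \<Rightarrow> 'a set \<Rightarrow> bool" where
  "ccr G B B' \<longleftrightarrow>
    (\<exists>u\<in>B. \<exists>v. {w. u \<rightarrow>\<^bsub>G\<^esub> w \<and> w \<notin> B} = {v} \<and> B' = insert v B)"

text \<open>
  \<open>zq_wins q G t B\<close>: from the set \<open>B\<close> of coloured vertices the player can force all vertices of
  \<open>G\<close> to become coloured after finitely many moves, spending at most \<open>t\<close> further tokens, however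
  the oracle responds. The strategy may depend on the responses. In \<open>query\<close>, \<open>S\<close> is the set of
  components announced and \<open>R\<close> the response, after which the rule may be applied in the induced
  subgraph any number of times (possibly none).
\<close>

inductive zq_wins :: "nat \<Rightarrow> ('a, 'b) pre_digraph \<Rightarrow> nat \<Rightarrow> 'a set \<Rightarrow> bool"
  for q :: nat and G :: "('a, 'b) pre_digraph" where
  finished: "verts G \<subseteq> B \<Longrightarrow> zq_wins q G t B"
| token: "v \<in> verts G - B \<Longrightarrow> zq_wins q G t (insert v B) \<Longrightarrow> zq_wins q G (Suc t) B"
| force: "ccr G B B' \<Longrightarrow> zq_wins q G t B' \<Longrightarrow> zq_wins q G t B"
| query: "S \<subseteq> pre_digraph.sccs_verts (G \<restriction> (verts G - B)) \<Longrightarrow> card S \<ge> q + 1 \<Longrightarrow>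
    (\<forall>R. R \<subseteq> S \<and> R \<noteq> {} \<longrightarrow>
      (\<exists>B'. (ccr (G \<restriction> (B \<union> \<Union>R)))\<^sup>*\<^sup>* B B' \<and> zq_wins q G t B')) \<Longrightarrow>
    zq_wins q G t B"

definition Zq :: "nat \<Rightarrow> ('a, 'b) pre_digraph \<Rightarrow> nat" where
  "Zq q G = (LEAST t. zq_wins q G t {})"

inductive zf_wins :: "('a, 'b) pre_digraph \<Rightarrow> nat \<Rightarrow> 'a set \<Rightarrow> bool"
  for G :: "('a, 'b) pre_digraph" where
  finished: "verts G \<subseteq> B \<Longrightarrow> zf_wins G t B"
| token: "v \<in> verts G - B \<Longrightarrow> zf_wins G t (insert v B) \<Longrightarrow> zf_wins G (Suc t) B"
| force: "ccr G B B' \<Longrightarrow> zf_wins G t B' \<Longrightarrow> zf_wins G t B"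

definition zero_forcing_number :: "('a, 'b) pre_digraph \<Rightarrow> nat" where
  "zero_forcing_number G = (LEAST t. zf_wins G t {})"

text \<open>On a finite graph the two minima are attained, so \<open>LEAST\<close> is meaningful.\<close>

lemma zf_wins_card:
  assumes "finite (verts G)"
  shows "zf_wins G (card (verts G - B)) B"
proof (induction "card (verts G - B)" arbitrary: B)
  case 0
  then show ?case using assms by (auto intro: zf_wins.finished)
next
  case (Suc k)
  then obtain v where v: "v \<in> verts G - B"
    by (metis card.empty equals0I nat.distinct(1))
  have "k = card (verts G - insert v B)"
    using Suc.hyps(2) v assms
    by (metis Diff_insert card_Diff_singleton diff_Suc_1)
  then have "zf_wins G k (insert v B)"
    using Suc.hyps(1) by blast
  then show ?case
    using v Suc.hyps(2) zf_wins.token by metis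
qed

lemma zf_wins_imp_zq_wins: "zf_wins G t B \<Longrightarrow> zq_wins q G t B"
  by (induction rule: zf_wins.induct) (blast intro: zq_wins.intros)+

end

theory Submission
  imports Defs
begin

text \<open>
  The forcing sets are a copy of \<open>K\<^sub>n\<close>, the first column of \<open>P\<^sub>n \<box> K\<^sub>2\<close> and two
  adjacent columns of \<open>C\<^sub>n \<box> K\<^sub>2\<close>. For the lower bounds the oracle always returns all the
  announced components. As long as the coloured vertices do not separate the graph, a query then
  gives no more than the ordinary rule, and fewer coloured vertices than the vertex connectivity
  (\<open>n\<close> and \<open>2\<close> in the first two cases) allow no force at all. The prism \<open>C\<^sub>n \<box> K\<^sub>2\<close> is
  only \<open>3\<close>-connected, but it is cubic and triangle-free, and its \<open>3\<close>-vertex separators are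
  neighbourhoods of single vertices. So after three tokens the player can at most complete one
  closed neighbourhood; this is not a separator and each of its coloured vertices has no
  uncoloured neighbour or at least two.
\<close>

section \<open>Unions of components and the two lower-bound criteria\<close>

text \<open>Only arcs leaving \<open>U\<close> are excluded; in a symmetric digraph this already
  makes \<open>U\<close> a union of components of the uncoloured part. The condition passes to what
  is left of \<open>U\<close> when some of its vertices become coloured, whereas the components
  themselves may break up.\<close>

definition component_union :: "('a, 'b) pre_digraph \<Rightarrow> 'a set \<Rightarrow> 'a set \<Rightarrow> bool" where
  "component_union G B U \<longleftrightarrow>
    U \<subseteq> verts G - B \<and> (\<forall>u\<in>U. \<forall>w\<in>verts G - B - U. \<not> u \<rightarrow>\<^bsub>G\<^esub> w)"

lemma dominates_induce_subgraph_iff: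
  "u \<rightarrow>\<^bsub>G \<restriction> X\<^esub> w \<longleftrightarrow> u \<rightarrow>\<^bsub>G\<^esub> w \<and> u \<in> X \<and> w \<in> X"
  by (force simp: arcs_ends_conv)

text \<open>By symmetry an arc between uncoloured vertices makes them mutually reachable, so both
  lie in one strongly connected component.\<close>

lemma (in sym_digraph) component_union_Union_sccs_verts:
  assumes "S \<subseteq> pre_digraph.sccs_verts (G \<restriction> (verts G - B))"
  shows "component_union G B (\<Union>S)"
proof -
  let ?H = "G \<restriction> (verts G - B)"
  interpret H: wf_digraph ?H by (rule wellformed_induce_subgraph)
  have "W \<subseteq> verts G - B" if "W \<in> S" for W
    using H.sccs_verts_subsets[of W] that assms by auto
  moreover have "\<not> u \<rightarrow>\<^bsub>G\<^esub> w" if "W \<in> S" "u \<in> W" "w \<in> verts G - B - \<Union>S" for W u w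
  proof
    assume "u \<rightarrow>\<^bsub>G\<^esub> w"
    have "u \<in> verts G - B" using calculation that by blast
    then have "u \<rightarrow>\<^bsub>?H\<^esub> w" "w \<rightarrow>\<^bsub>?H\<^esub> u"
      using \<open>u \<rightarrow>\<^bsub>G\<^esub> w\<close> that arcs_ends_symmetric[OF sym_arcs]
      unfolding dominates_induce_subgraph_iff by auto
    then have "u \<rightarrow>\<^sup>*\<^bsub>?H\<^esub> w" "w \<rightarrow>\<^sup>*\<^bsub>?H\<^esub> u" by auto
    then show False
      using that assms unfolding H.sccs_verts_def by blast
  qed
  ultimately show ?thesis
    unfolding component_union_def by blast
qed

text \<open>
  The oracle answers every query with all the announced components. The rule may be applied
  repeatedly after one query, but each single application is again a step inside a union of
  components with respect to the enlarged coloured set.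
\<close>

lemma (in sym_digraph) not_zq_wins_invariant:
  assumes unfinished: "\<And>t B. P t B \<Longrightarrow> B \<subset> verts G"
    and token: "\<And>t B v. P (Suc t) B \<Longrightarrow> v \<in> verts G - B \<Longrightarrow> P t (insert v B)"
    and force: "\<And>t B U u v. P t B \<Longrightarrow> component_union G B U \<Longrightarrow> u \<in> B \<Longrightarrow>
      {w \<in> U. u \<rightarrow>\<^bsub>G\<^esub> w} = {v} \<Longrightarrow> P t (insert v B)"
    and start: "P t B"
  shows "\<not> zq_wins q G t B"
proof
  assume "zq_wins q G t B"
  then have "\<not> P t B"
  proof induction
    case (finished B t)
    then show ?case using unfinished[of t B] by auto
  next
    case (token v B t)
    then show ?case using assms(2) by blast
  next
    case (force B B' t)
    show ?case
    proof
      assume P: "P t B"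
      obtain u v where uv: "u \<in> B" "{w. u \<rightarrow>\<^bsub>G\<^esub> w \<and> w \<notin> B} = {v}" "B' = insert v B"
        using force.hyps unfolding ccr_def by blast
      have "{w \<in> verts G - B. u \<rightarrow>\<^bsub>G\<^esub> w} = {w. u \<rightarrow>\<^bsub>G\<^esub> w \<and> w \<notin> B}"
        using adj_in_verts(2) by auto
      \<comment> \<open>The ordinary rule is the instance \<open>U = verts G - B\<close> of the
        hypothesis on forces.\<close>
      moreover have "component_union G B (verts G - B)"
        by (auto simp: component_union_def)
      ultimately have "P t B'"
        using assms(3)[OF P, of "verts G - B" u v] uv by simp
      with force.IH show False by blast
    qed
  next
    case (query S B t)
    show ?case
    proof
      assume P: "P t B"
      let ?U = "\<Union>S"
      have U: "component_union G B ?U"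
        using component_union_Union_sccs_verts query.hyps(1) .
      \<comment> \<open>Since \<open>S\<close> is nonempty, returning all of it is a legal answer,
        whatever \<open>q\<close> is.\<close>
      have "S \<noteq> {}" using query.hyps(2) by auto
      then obtain B' where B': "(ccr (G \<restriction> (B \<union> ?U)))\<^sup>*\<^sup>* B B'" "\<not> P t B'"
        using query.IH by blast
      from B'(1) have "P t B' \<and> B \<subseteq> B' \<and> B' \<subseteq> B \<union> ?U"
      proof (induction rule: rtranclp_induct)
        case base
        then show ?case using P by auto
      next
        case (step C C')
        obtain u v where uv: "u \<in> C"
          "{w. u \<rightarrow>\<^bsub>G \<restriction> (B \<union> ?U)\<^esub> w \<and> w \<notin> C} = {v}" "C' = insert v C"
          using step.hyps(2) unfolding ccr_def by blast
        let ?W = "B \<union> ?U - C"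
        have "component_union G C ?W"
          using U step.IH unfolding component_union_def by blast
        moreover have *: "{w \<in> ?W. u \<rightarrow>\<^bsub>G\<^esub> w} = {v}"
          using uv(1) step.IH
          unfolding uv(2)[symmetric] dominates_induce_subgraph_iff by blast
        ultimately have "P t C'"
          using force[of t C ?W u v] step.IH uv by simp
        moreover have "v \<in> ?W" using * by blast
        ultimately show ?case using step.IH uv(3) by blast
      qed
      with B'(2) show False by blast
    qed
  qed
  with start show False by blast
qed

text \<open>
  If a coloured vertex \<open>u\<close> had a single uncoloured neighbour \<open>v\<close>, then exchanging \<open>u\<close> for \<open>v\<close>
  in the coloured set would give a separator of the same size that isolates \<open>u\<close>.
\<close>

lemma (in sym_digraph) zq_wins_connectivity:
  assumes fin: "finite (verts G)" and k: "k < card (verts G)"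
    and conn: "\<And>B U. B \<subseteq> verts G \<Longrightarrow> card B < k \<Longrightarrow> component_union G B U \<Longrightarrow>
      U = {} \<or> U = verts G - B"
    and wins: "zq_wins q G t {}"
  shows "k \<le> t"
proof (rule ccontr)
  assume "\<not> k \<le> t"
  have "\<not> zq_wins q G t {}"
  proof (rule not_zq_wins_invariant[where P = "\<lambda>t B. B \<subseteq> verts G \<and> card B + t < k"])
    fix t B v
    assume "B \<subseteq> verts G \<and> card B + Suc t < k" "v \<in> verts G - B"
    then show "insert v B \<subseteq> verts G \<and> card (insert v B) + t < k"
      using fin by (auto simp: card_insert_if finite_subset)
  next
    fix t B U u v
    assume B: "B \<subseteq> verts G \<and> card B + t < k" and U: "component_union G B U"
      and u: "u \<in> B" and v: "{w \<in> U. u \<rightarrow>\<^bsub>G\<^esub> w} = {v}"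
    have finB: "finite B" using B fin finite_subset by blast
    have "card B < k" using B by linarith
    then have UB: "U = verts G - B" using conn[OF _ _ U] B v by blast
    then have vB: "v \<in> verts G - B" using v by blast
    let ?C = "insert v (B - {u})"
    have "card ?C = card B"
      using vB card_Suc_Diff1[OF finB u] finB by simp
    moreover have "component_union G ?C {u}"
      using v vB u B unfolding component_union_def UB by blast
    \<comment> \<open>As \<open>{u}\<close> is nonempty, it must be everything outside
      \<open>?C\<close>. Then \<open>insert v B\<close> exhausts the graph, too few vertices in view
      of \<open>card B < k < card (verts G)\<close>.\<close>
    ultimately have "{u} = verts G - ?C"
      using conn[of ?C "{u}"] B vB \<open>card B < k\<close>
      by (metis Diff_iff Diff_subset insert_not_empty insert_subset subset_trans)
    then have "verts G - ?C \<subseteq> {u}" by simp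
    then have "verts G \<subseteq> insert v B" using u by blast
    then have "card (verts G) \<le> Suc (card B)"
      using finB card_mono[of "insert v B" "verts G"]
      by (simp add: card_insert_if split: if_splits)
    with k B show "insert v B \<subseteq> verts G \<and> card (insert v B) + t < k" by linarith
  next
    fix t B
    assume "B \<subseteq> verts G \<and> card B + t < k"
    then show "B \<subset> verts G" using k by (metis add_lessD1 order.strict_trans order.irrefl psubsetI)
  next
    show "{} \<subseteq> verts G \<and> card {} + t < k" using \<open>\<not> k \<le> t\<close> by simp
  qed
  with wins show False by blast
qed

text \<open>The invariant has one stage beyond the budget of three: with no token left, a single
  force may complete a closed neighbourhood. There forcing stops, by 3-regularity and the absence of
  triangles.\<close>

lemma (in sym_digraph) zq_wins_cubic:
  assumes fin: "finite (verts G)" and large: "4 < card (verts G)"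
    and cubic: "\<And>u. u \<in> verts G \<Longrightarrow> card {w. u \<rightarrow>\<^bsub>G\<^esub> w} = 3"
    and triangle_free: "\<And>u v w. u \<rightarrow>\<^bsub>G\<^esub> v \<Longrightarrow> v \<rightarrow>\<^bsub>G\<^esub> w \<Longrightarrow> \<not> u \<rightarrow>\<^bsub>G\<^esub> w"
    and small_cut: "\<And>B U. B \<subseteq> verts G \<Longrightarrow> card B \<le> 3 \<Longrightarrow> component_union G B U \<Longrightarrow>
      U = {} \<or> U = verts G - B \<or>
      (\<exists>y\<in>verts G. B = {w. y \<rightarrow>\<^bsub>G\<^esub> w} \<and> (U = {y} \<or> U = verts G - B - {y}))"
    and nbhd_cut: "\<And>c U. c \<in> verts G \<Longrightarrow> component_union G (insert c {w. c \<rightarrow>\<^bsub>G\<^esub> w}) U \<Longrightarrow>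
      U = {} \<or> U = verts G - insert c {w. c \<rightarrow>\<^bsub>G\<^esub> w}"
    and wins: "zq_wins q G t {}"
  shows "4 \<le> t"
proof (rule ccontr)
  assume "\<not> 4 \<le> t"
  define N where "N u = {w. u \<rightarrow>\<^bsub>G\<^esub> w}" for u
  define P where "P t B \<longleftrightarrow> B \<subseteq> verts G \<and>
    (card B + t \<le> 3 \<or> t = 0 \<and> (\<exists>c\<in>verts G. B = insert c (N c)))" for t B
  have NV: "N u \<subseteq> verts G" for u by (auto simp: N_def)
  have finN: "finite (N u)" for u using NV fin finite_subset by blast
  have cardN: "card (N u) = 3" if "u \<in> verts G" for u using cubic that by (simp add: N_def)
  have cardV: "card B < card (verts G)" if "P t B" for t B
  proof -
    have "card B \<le> 4"
      using that finN cardN unfolding P_def by (auto simp: card_insert_if)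
    then show ?thesis using large by linarith
  qed
  have "\<not> zq_wins q G t {}"
  proof (rule not_zq_wins_invariant[where P = P])
    fix t B assume "P t B"
    then show "B \<subset> verts G" using cardV[of t B] unfolding P_def by auto
  next
    fix t B v
    assume "P (Suc t) B" "v \<in> verts G - B"
    then show "P t (insert v B)"
      using fin unfolding P_def by (auto simp: card_insert_if finite_subset)
  next
    fix t B U u v
    assume P: "P t B" and U: "component_union G B U"
      and u: "u \<in> B" and v: "{w \<in> U. u \<rightarrow>\<^bsub>G\<^esub> w} = {v}"
    have BV: "B \<subseteq> verts G" using P unfolding P_def by blast
    then have uV: "u \<in> verts G" and finB: "finite B" using u fin finite_subset by blast+
    have vU: "v \<in> U" and uv: "u \<rightarrow>\<^bsub>G\<^esub> v" using v by blast+
    have vV: "v \<in> verts G - B" using vU U unfolding component_union_def by blast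
    \<comment> \<open>If at most one neighbour of \<open>u\<close> lies outside \<open>U\<close>,
      then \<open>u\<close> sees at least two vertices of \<open>U\<close> and cannot force.\<close>
    have two: False if "y \<in> verts G" "u \<in> N y" "N u - {y} \<subseteq> U" for y
    proof -
      have "N u \<subseteq> {y, v}" using v that unfolding N_def by blast
      then have "card (N u) \<le> card {y, v}"
        by (intro card_mono) auto
      also have "\<dots> \<le> 2" by (simp add: card_insert_if)
      finally have "card (N u) \<le> 2" .
      then show False using cardN[OF uV] by linarith
    qed
    have indep: "N u \<inter> N y = {}" if "u \<in> N y" for y
      using that triangle_free unfolding N_def by blast
    consider (few) "card B + t \<le> 3" | (nbhd) c where "t = 0" "c \<in> verts G" "B = insert c (N c)"
      using P unfolding P_def by blast
    then show "P t (insert v B)"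
    proof cases
      case few
      then have "card B \<le> 3" by linarith
      then consider (all) "U = verts G - B" | (cut) y where "y \<in> verts G" "B = N y"
        "U = {y} \<or> U = verts G - B - {y}"
        using small_cut[OF BV _ U] vU unfolding N_def by blast
      then show ?thesis
      proof cases
        case all
        \<comment> \<open>Without separation the force is an ordinary one, so \<open>u\<close> and
          its two other neighbours are coloured. They use up the whole budget, and \<open>v\<close>
          completes the closed neighbourhood of \<open>u\<close>.\<close>
        have sub: "insert u (N u - {v}) \<subseteq> B"
          using u v NV[of u] unfolding all N_def by blast
        have "u \<notin> N u" using triangle_free[of u u u] unfolding N_def by blast
        then have "card (insert u (N u - {v})) = 3"
          using finN cardN[OF uV] uv by (simp add: N_def card_Diff_singleton)
        then have "card B = 3" "t = 0"
          using card_mono[OF finB sub] few by linarith+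
        then have "insert u (N u - {v}) = B"
          using card_seteq[OF finB sub] \<open>card (insert u (N u - {v})) = 3\<close> by simp
        then have "insert v B = insert u (N u)"
          using uv unfolding N_def by blast
        then show ?thesis
          using BV vV uV \<open>t = 0\<close> unfolding P_def by blast
      next
        case cut
        have "t = 0" using few cut(2) cardN[OF cut(1)] by simp
        show ?thesis
        proof (cases "U = {y}")
          case True
          then have "insert v B = insert y (N y)" using vU cut(2) by blast
          then show ?thesis
            using \<open>t = 0\<close> cut(1) vV BV unfolding P_def by blast
        next
          case False
          \<comment> \<open>Here \<open>u\<close> is a neighbour of \<open>y\<close>, so without
            triangles none of its neighbours lies in \<open>B = N y\<close>.\<close>
          then have "N u - {y} \<subseteq> U"
            using indep u cut NV[of u] by blast
          then show ?thesis using two u cut by blast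
        qed
      qed
    next
      case nbhd
      have UV: "U = verts G - B"
        using nbhd_cut[of c U] nbhd U vU unfolding N_def by blast
      \<comment> \<open>The centre has no uncoloured neighbour left, so \<open>u\<close> is one of
        the three neighbours of \<open>c\<close>; its other two neighbours are uncoloured.\<close>
      have "u \<noteq> c" using uv vV nbhd unfolding N_def by blast
      then have "u \<in> N c" using u nbhd by blast
      moreover from this have "N u - {c} \<subseteq> U"
        using indep NV[of u] unfolding UV nbhd by blast
      ultimately show ?thesis using two nbhd by blast
    qed
  next
    show "P t {}" using \<open>\<not> 4 \<le> t\<close> unfolding P_def by auto
  qed
  with wins show False by blast
qed

section \<open>From a forcing set and a lower bound to the common value\<close>

lemma zf_wins_tokens:
  assumes "finite T" "T \<subseteq> verts G - B" "zf_wins G t (T \<union> B)"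
  shows "zf_wins G (card T + t) B"
  using assms
proof (induction T arbitrary: B rule: finite_induct)
  case (insert v T)
  have "zf_wins G (card T + t) (insert v B)"
    using insert by (intro insert.IH) auto
  then show ?case
    using insert zf_wins.token[of v G B] by simp
qed simp

text \<open>A zero forcing strategy wins every \<open>Zq\<close> game, so one upper bound without
  queries and one lower bound uniform in \<open>q\<close> settle all the numbers.\<close>

lemma forcing_numbers_eqI:
  assumes "zf_wins G k {}" and "\<And>q t. zq_wins q G t {} \<Longrightarrow> k \<le> t"
  shows "(\<forall>q. Zq q G = k) \<and> zero_forcing_number G = k"
proof -
  have zq: "zq_wins q G k {}" for q
    using assms(1) by (rule zf_wins_imp_zq_wins)
  have "Zq q G = k" for q
    unfolding Zq_def using zq assms(2) by (rule Least_equality)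
  moreover have "k \<le> t" if "zf_wins G t {}" for t
    using zf_wins_imp_zq_wins[OF that, of 0] by (rule assms(2))
  then have "zero_forcing_number G = k"
    unfolding zero_forcing_number_def using assms(1) by (intro Least_equality)
  ultimately show ?thesis by blast
qed

section \<open>Prisms over an arbitrary base graph\<close>

abbreviation prism :: "'a pair_pre_digraph \<Rightarrow> ('a \<times> nat, ('a \<times> nat) \<times> ('a \<times> nat)) pre_digraph" where
  "prism G \<equiv> with_proj (G \<box> complete_graph 2)"

lemma verts_prism: "verts (prism G) = pverts G \<times> {..<2}"
  by (simp add: box_product_def complete_graph_def)

lemma dominates_prism_iff:
  "(i, s) \<rightarrow>\<^bsub>prism G\<^esub> (j, r) \<longleftrightarrow>
    s < 2 \<and> r < 2 \<and> (i = j \<and> i \<in> pverts G \<and> s \<noteq> r \<or> (i, j) \<in> parcs G \<and> s = r)"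
  by (auto simp: box_product_def complete_graph_def)

text \<open>These rules would unfold \<^term>\<open>verts (prism G)\<close> before \<open>verts_prism\<close> applies.\<close>

declare with_proj_simps [simp del]

lemma pverts_complete_graph: "pverts (complete_graph n) = {..<n}"
  by (simp add: complete_graph_def)

lemma pverts_path_graph: "pverts (path_graph n) = {..<n}"
  by (simp add: path_graph_def)

lemma pverts_cycle_graph: "pverts (cycle_graph n) = {..<n}"
  by (simp add: cycle_graph_def)

lemma sym_digraph_prism:
  assumes "pair_graph G"
  shows "sym_digraph (prism G)"
proof -
  have "pair_graph (complete_graph 2)"
    using complete_digraph_complete_graph by (rule pair_graphI_complete)
  then interpret pair_graph "G \<box> complete_graph 2"
    by (rule pair_graph_box_product[OF assms])
  show ?thesis by unfold_locales
qed

lemma (in sym_digraph) component_union_adj: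
  assumes "component_union G B U" "u \<rightarrow>\<^bsub>G\<^esub> w" "u \<notin> B" "w \<notin> B"
  shows "u \<in> U \<longleftrightarrow> w \<in> U"
  using assms arcs_ends_symmetric[OF sym_arcs assms(2)] adj_in_verts[OF assms(2)]
  unfolding component_union_def by blast

text \<open>Connectedness after deleting \<open>B\<close> is proved in this form:
  \<open>component_union_adj\<close> carries membership in \<open>U\<close> along paths avoiding
  \<open>B\<close>, until it is seen to have one truth value \<open>b\<close>.\<close>

lemma component_union_trivial:
  assumes "component_union G B U" "\<And>x. x \<in> verts G - B \<Longrightarrow> x \<in> U \<longleftrightarrow> b"
  shows "U = {} \<or> U = verts G - B"
  using assms unfolding component_union_def by (cases b) blast+

text \<open>Colour spreads one column at a time: by the last hypothesis, column \<open>j\<close> is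
  the only one from \<open>j\<close> on that is adjacent to column \<open>j - 1\<close>, so each
  vertex of column \<open>j - 1\<close> forces its neighbour in the same row.\<close>

lemma zf_wins_prism_columns:
  fixes k n :: nat
  assumes "k \<le> n" "pverts G = {..<n}"
    and "\<And>j. k \<le> j \<Longrightarrow> j < n \<Longrightarrow> 0 < j \<and> {w. (j - 1, w) \<in> parcs G \<and> j \<le> w} = {j}"
  shows "zf_wins (prism G) 0 ({..<k} \<times> {..<2})"
  using assms(1)
proof (induction rule: inc_induct)
  case base
  show ?case by (rule zf_wins.finished) (simp add: verts_prism assms(2))
next
  case (step m)
  have m: "0 < m" and arcs: "(m - 1, w) \<in> parcs G \<and> m \<le> w \<longleftrightarrow> w = m" for w
    using assms(3)[of m] step.hyps by auto
  let ?B = "{..<m} \<times> {..<2::nat}"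
  have "{w. (m - 1, 0) \<rightarrow>\<^bsub>prism G\<^esub> w \<and> w \<notin> ?B} = {(m, 0)}"
    using m arcs by (force simp: dominates_prism_iff not_less)
  then have 1: "ccr (prism G) ?B (insert (m, 0) ?B)"
    unfolding ccr_def using m by (intro bexI[of _ "(m - 1, 0)"] exI[of _ "(m, 0)"]) auto
  have "{w. (m - 1, 1) \<rightarrow>\<^bsub>prism G\<^esub> w \<and> w \<notin> insert (m, 0) ?B} = {(m, 1)}"
    using m arcs by (force simp: dominates_prism_iff not_less)
  then have 2: "ccr (prism G) (insert (m, 0) ?B) (insert (m, 1) (insert (m, 0) ?B))"
    unfolding ccr_def using m by (intro bexI[of _ "(m - 1, 1)"] exI[of _ "(m, 1)"]) auto
  have "insert (m, 1) (insert (m, 0) ?B) = {..<Suc m} \<times> {..<2}"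
    by (auto simp: less_2_cases_iff less_Suc_eq)
  then show ?case
    using zf_wins.force[OF 1 zf_wins.force[OF 2]] step.IH by simp
qed

section \<open>Prisms over complete graphs\<close>

lemma forcing_numbers_prism_complete_graph:
  "(\<forall>q. Zq q (prism (complete_graph n)) = n) \<and> zero_forcing_number (prism (complete_graph n)) = n"
proof -
  let ?G = "prism (complete_graph n)"
  interpret sym_digraph ?G
    using complete_digraph_complete_graph by (intro sym_digraph_prism pair_graphI_complete)
  have verts: "verts ?G = {..<n} \<times> {..<2}"
    by (simp add: verts_prism pverts_complete_graph)
  have dom: "(i, s) \<rightarrow>\<^bsub>?G\<^esub> (j, r) \<longleftrightarrow>
      s < 2 \<and> r < 2 \<and> i < n \<and> j < n \<and> (i = j \<and> s \<noteq> r \<or> i \<noteq> j \<and> s = r)" for i j s r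
    unfolding dominates_prism_iff by (auto simp: complete_graph_def)
  \<comment> \<open>Row 0 is coloured, and each of its vertices forces its partner in row 1.\<close>
  have "zf_wins ?G 0 ({..<n} \<times> {0} \<union> {..<k} \<times> {1})" if "k \<le> n" for k
    using that
  proof (induction rule: inc_induct)
    case base
    show ?case by (rule zf_wins.finished) (auto simp only: verts less_2_cases_iff)
  next
    case (step m)
    let ?B = "{..<n} \<times> {0} \<union> {..<m} \<times> {1::nat}"
    have "{w. (m, 0) \<rightarrow>\<^bsub>?G\<^esub> w \<and> w \<notin> ?B} = {(m, 1)}"
      using step.hyps by (force simp: dom)
    then have ccr: "ccr ?G ?B (insert (m, 1) ?B)"
      unfolding ccr_def using step.hyps
      by (intro bexI[of _ "(m, 0)"] exI[of _ "(m, 1)"]) auto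
    have "insert (m, 1) ?B = {..<n} \<times> {0} \<union> {..<Suc m} \<times> {1}"
      by (auto simp: less_Suc_eq)
    then show ?case using zf_wins.force[OF ccr] step.IH by simp
  qed
  from this[of 0] have "zf_wins ?G 0 ({..<n} \<times> {0})" by simp
  then have upper: "zf_wins ?G n {}"
    using zf_wins_tokens[of "{..<n} \<times> {0}" ?G "{}" 0]
    by (simp add: verts card_cartesian_product Sigma_mono)
  have lower: "n \<le> t" if wins: "zq_wins q ?G t {}" for q t
  \<comment> \<open>For \<open>n = 0\<close> the strict bound \<open>k < card (verts G)\<close> of
    \<open>zq_wins_connectivity\<close> fails.\<close>
  proof (cases "n = 0")
    case False
    show ?thesis
    proof (rule zq_wins_connectivity[OF _ _ _ wins])
      fix B U
      assume B: "B \<subseteq> verts ?G" "card B < n" and U: "component_union ?G B U"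
      have "finite B" using B(1) unfolding verts by (rule finite_subset) simp
      then have "card (fst ` B) < n" using B(2) card_image_le[of B fst] by linarith
      then have "\<not> {..<n} \<subseteq> fst ` B"
        using \<open>finite B\<close> card_mono[of "fst ` B" "{..<n}"] by auto
      \<comment> \<open>Column \<open>i\<close> is entirely uncoloured; each other uncoloured vertex
        is adjacent to the vertex of this column in its own row.\<close>
      then obtain i where i: "i < n" "\<And>s. (i, s) \<notin> B" by force
      show "U = {} \<or> U = verts ?G - B"
      proof (rule component_union_trivial[OF U])
        fix x assume x: "x \<in> verts ?G - B"
        obtain j s where js: "x = (j, s)" "j < n" "s < 2"
          using x unfolding verts by blast
        have "x \<in> U \<longleftrightarrow> (i, s) \<in> U"
        proof (cases "j = i")
          case False
          then show ?thesis
            using component_union_adj[OF U, of x "(i, s)"] x js i by (simp add: dom)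
        qed (simp add: js)
        also have "\<dots> \<longleftrightarrow> (i, 0) \<in> U"
          using component_union_adj[OF U, of "(i, s)" "(i, 0)"] js i
          by (cases "s = 0") (simp_all add: dom)
        finally show "x \<in> U \<longleftrightarrow> (i, 0) \<in> U" .
      qed
    qed (use False in \<open>simp_all add: verts card_cartesian_product\<close>)
  qed simp
  show ?thesis using upper lower by (rule forcing_numbers_eqI)
qed

section \<open>Prisms over paths\<close>

lemma forcing_numbers_prism_path_graph:
  assumes "2 \<le> n"
  shows "(\<forall>q. Zq q (prism (path_graph n)) = 2) \<and> zero_forcing_number (prism (path_graph n)) = 2"
proof -
  let ?G = "prism (path_graph n)"
  interpret sym_digraph ?G
    using pair_graph_path_graph by (rule sym_digraph_prism)
  have verts: "verts ?G = {..<n} \<times> {..<2}"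
    by (simp add: verts_prism pverts_path_graph)
  have dom: "(i, s) \<rightarrow>\<^bsub>?G\<^esub> (j, r) \<longleftrightarrow>
      s < 2 \<and> r < 2 \<and> i < n \<and> j < n \<and> (i = j \<and> s \<noteq> r \<or> (j = Suc i \<or> i = Suc j) \<and> s = r)"
    for i j s r
    unfolding dominates_prism_iff by (auto simp: path_graph_def)
  have "zf_wins ?G 0 ({..<1} \<times> {..<2})"
    using assms by (intro zf_wins_prism_columns[of _ n]) (auto simp: path_graph_def)
  then have upper: "zf_wins ?G 2 {}"
    using zf_wins_tokens[of "{..<1} \<times> {..<2}" ?G "{}" 0] assms
    by (simp add: verts card_cartesian_product Sigma_mono)
  have lower: "2 \<le> t" if wins: "zq_wins q ?G t {}" for q t
  proof (rule zq_wins_connectivity[OF _ _ _ wins])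
    fix B U
    assume B: "B \<subseteq> verts ?G" "card B < 2" and U: "component_union ?G B U"
    have "finite B" using B(1) unfolding verts by (rule finite_subset) simp
    then have one: "x = y" if "x \<in> B" "y \<in> B" for x y
      using B(2) that card_le_Suc0_iff_eq[of B] by auto
    \<comment> \<open>At most one vertex is coloured, so one row is free. That row is connected, and
      the other row hangs on it by the column edges.\<close>
    have "\<exists>s<2. \<forall>j. (j, s) \<notin> B"
    proof (cases "\<exists>j. (j, 0) \<in> B")
      case True
      then show ?thesis using one by (intro exI[of _ 1]) force
    next
      case False
      then show ?thesis by (intro exI[of _ 0]) simp
    qed
    then obtain s where s: "s < 2" "\<And>j. (j, s) \<notin> B" by blast
    have row: "(j, s) \<in> U \<longleftrightarrow> (0, s) \<in> U" if "j < n" for j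
      using that
    proof (induction j)
      case (Suc j)
      then show ?case
        using component_union_adj[OF U, of "(j, s)" "(Suc j, s)"] s
        by (simp add: dom)
    qed simp
    show "U = {} \<or> U = verts ?G - B"
    proof (rule component_union_trivial[OF U])
      fix x assume x: "x \<in> verts ?G - B"
      obtain j r where jr: "x = (j, r)" "j < n" "r < 2"
        using x unfolding verts by blast
      then have "x \<in> U \<longleftrightarrow> (j, s) \<in> U"
        using component_union_adj[OF U, of x "(j, s)"] x s
        by (cases "r = s") (simp_all add: dom)
      then show "x \<in> U \<longleftrightarrow> (0, s) \<in> U" using row[OF jr(2)] by blast
    qed
  qed (use assms in \<open>simp_all add: verts card_cartesian_product\<close>)
  show ?thesis using upper lower by (rule forcing_numbers_eqI)
qed

section \<open>Prisms over cycles\<close>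

lemma cycle_graph_arc_iff:
  assumes "2 \<le> n"
  shows "(i, j) \<in> parcs (cycle_graph n) \<longleftrightarrow> i < n \<and> j < n \<and>
    (j = Suc i \<or> i = Suc j \<or> i = 0 \<and> Suc j = n \<or> j = 0 \<and> Suc i = n)"
proof -
  have "j = Suc i mod n \<longleftrightarrow> j = Suc i \<or> j = 0 \<and> Suc i = n" if "i < n" "j < n" for i j
    using that by (cases "Suc i = n") auto
  from this[of i j] this[of j i] show ?thesis
    by (auto simp: cycle_graph_def)
qed

text \<open>For \<open>n = 3\<close> the prism contains triangles and coincides with that of
  \<open>complete_graph 3\<close>, whose value is 3.\<close>

lemma forcing_numbers_prism_cycle_graph:
  assumes n: "4 \<le> n"
  shows "(\<forall>q. Zq q (prism (cycle_graph n)) = 4) \<and> zero_forcing_number (prism (cycle_graph n)) = 4"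
proof -
  let ?G = "prism (cycle_graph n)"
  interpret sym_digraph ?G
    using n by (intro sym_digraph_prism pair_graph_cycle_graph) simp
  have verts: "verts ?G = {..<n} \<times> {..<2}"
    by (simp add: verts_prism pverts_cycle_graph)
  have dom: "(i, s) \<rightarrow>\<^bsub>?G\<^esub> (j, r) \<longleftrightarrow> s < 2 \<and> r < 2 \<and> i < n \<and> j < n \<and>
      (i = j \<and> s \<noteq> r \<or>
       (j = Suc i \<or> i = Suc j \<or> i = 0 \<and> Suc j = n \<or> j = 0 \<and> Suc i = n) \<and> s = r)"
    for i j s r
    unfolding dominates_prism_iff using n
    by (auto simp: cycle_graph_arc_iff pverts_cycle_graph)
  define nxt where "nxt i = (if Suc i = n then 0 else Suc i)" for i
  define prv where "prv i = (if i = 0 then n - 1 else i - 1)" for i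
  have cyc: "i < n \<and> j < n \<and> (j = Suc i \<or> i = Suc j \<or> i = 0 \<and> Suc j = n \<or> j = 0 \<and> Suc i = n) \<longleftrightarrow>
      j = nxt i \<or> j = prv i" if "i < n" for i j
    unfolding nxt_def prv_def using that n by auto
  have "(i, s) \<rightarrow>\<^bsub>?G\<^esub> (j, r) \<longleftrightarrow> (j, r) \<in> {(nxt i, s), (prv i, s), (i, 1 - s)}"
    if "i < n" "s < 2" for i s j r
  proof -
    have "r < 2 \<and> s \<noteq> r \<longleftrightarrow> r = 1 - s" using \<open>s < 2\<close> by arith
    then show ?thesis
      unfolding dom using that cyc[OF \<open>i < n\<close>, of j] by auto
  qed
  then have nbrs: "{w. (i, s) \<rightarrow>\<^bsub>?G\<^esub> w} = {(nxt i, s), (prv i, s), (i, 1 - s)}"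
    if "i < n" "s < 2" for i s
    using that by auto
  have distinct: "nxt i < n" "prv i < n" "nxt i \<noteq> i" "prv i \<noteq> i" "nxt i \<noteq> prv i" if "i < n" for i
    using that n by (auto simp: nxt_def prv_def)
  have card3: "card {w. (i, s) \<rightarrow>\<^bsub>?G\<^esub> w} = 3" if "i < n" "s < 2" for i s
    using distinct[OF that(1)] that by (simp add: nbrs)
  \<comment> \<open>Row \<open>s\<close> without column \<open>i\<close> is an uncoloured path, and
    every vertex of the other row off that column is attached to it. Column \<open>i\<close> needs
    separate care, since one of its vertices may be isolated.\<close>
  have off_column: "\<exists>b. \<forall>j<n. \<forall>r<2. j \<noteq> i \<longrightarrow> (j, r) \<notin> B \<longrightarrow> ((j, r) \<in> U \<longleftrightarrow> b)"
    if U: "component_union ?G B U" and "i < n" and s: "s < 2"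
      and row: "\<And>j. (j, s) \<in> B \<Longrightarrow> j = i" for B U i s
  proof -
    have row': "(j, s) \<notin> B" if "j \<noteq> i" for j using row that by blast
    have succ: "(j, s) \<in> U \<longleftrightarrow> (Suc j, s) \<in> U" if "Suc j < n" "j \<noteq> i" "Suc j \<noteq> i" for j
      using that s by (intro component_union_adj[OF U]) (simp_all add: dom row')
    have left: "(j, s) \<in> U \<longleftrightarrow> (0, s) \<in> U" if "j < i" for j
      using that
    proof (induction j)
      case (Suc j)
      then have "j < i" "Suc j < n" "j \<noteq> i" "Suc j \<noteq> i" using \<open>i < n\<close> by auto
      then show ?case using succ[of j] Suc.IH by blast
    qed simp
    have right: "(j, s) \<in> U \<longleftrightarrow> (n - 1, s) \<in> U" if "i < j" "j \<le> n - 1" for j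
      using that(2) \<open>i < j\<close>
    proof (induction rule: inc_induct)
      case (step m)
      then have "i < Suc m" "Suc m < n" "m \<noteq> i" "Suc m \<noteq> i" by auto
      then show ?case using succ[of m] step.IH by blast
    qed simp
    \<comment> \<open>The two segments of the row, below and above \<open>i\<close>, are joined by
      the wrap-around edge. If \<open>i\<close> is 0 or \<open>n - 1\<close>, one of them is
      empty.\<close>
    have wrap: "(0, s) \<in> U \<longleftrightarrow> (n - 1, s) \<in> U" if "0 < i" "i < n - 1"
      using component_union_adj[OF U, of "(0, s)" "(n - 1, s)"] that n s
      by (simp add: dom row')
    define b where "b \<longleftrightarrow> (if i = 0 then (n - 1, s) \<in> U else (0, s) \<in> U)"
    have rowb: "(j, s) \<in> U \<longleftrightarrow> b" if "j < n" "j \<noteq> i" for j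
    proof (cases "j < i")
      case True
      then have "i \<noteq> 0" by simp
      with left[OF True] show ?thesis unfolding b_def by presburger
    next
      case False
      with that have "i < j" "j \<le> n - 1" "i < n - 1" by auto
      then show ?thesis using right[of j] wrap unfolding b_def by (metis neq0_conv)
    qed
    have "(j, r) \<in> U \<longleftrightarrow> b" if "j < n" "r < 2" "j \<noteq> i" "(j, r) \<notin> B" for j r
    proof -
      have "(j, r) \<in> U \<longleftrightarrow> (j, s) \<in> U"
      proof (cases "r = s")
        case False
        with that s show ?thesis
          by (intro component_union_adj[OF U]) (simp_all add: dom row')
      qed simp
      then show ?thesis using rowb that by blast
    qed
    then show ?thesis by (intro exI[of _ b]) simp
  qed
  \<comment> \<open>Two columns are needed here, because column 0 is also adjacent to column
    \<open>n - 1\<close>.\<close>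
  have "zf_wins ?G 0 ({..<2} \<times> {..<2})"
    using n
    by (intro zf_wins_prism_columns[of _ n]) (auto simp: cycle_graph_arc_iff pverts_cycle_graph)
  then have upper: "zf_wins ?G 4 {}"
    using zf_wins_tokens[of "{..<2} \<times> {..<2}" ?G "{}" 0] n
    by (simp add: verts card_cartesian_product Sigma_mono)
  have lower: "4 \<le> t" if wins: "zq_wins q ?G t {}" for q t
  proof (rule zq_wins_cubic[OF _ _ _ _ _ _ wins])
    fix u assume "u \<in> verts ?G"
    then show "card {w. u \<rightarrow>\<^bsub>?G\<^esub> w} = 3"
      unfolding verts by (cases u) (simp add: card3)
  next
    fix u v w assume "u \<rightarrow>\<^bsub>?G\<^esub> v" "v \<rightarrow>\<^bsub>?G\<^esub> w"
    then show "\<not> u \<rightarrow>\<^bsub>?G\<^esub> w"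
      using n by (cases u; cases v; cases w) (auto simp: dom)
  next
    fix c U
    assume c: "c \<in> verts ?G" and U: "component_union ?G (insert c {w. c \<rightarrow>\<^bsub>?G\<^esub> w}) U"
    obtain i s where c_eq: "c = (i, s)" "i < n" "s < 2" using c unfolding verts by blast
    define B where "B = insert c {w. c \<rightarrow>\<^bsub>?G\<^esub> w}"
    have B: "B = {(i, s), (nxt i, s), (prv i, s), (i, 1 - s)}"
      unfolding B_def c_eq(1) using nbrs c_eq by auto
    have column: "(i, r) \<in> B" if "r < 2" for r
      using that c_eq unfolding B by (auto simp: less_2_cases_iff)
    have "1 - s \<noteq> s" by presburger
    \<comment> \<open>Row \<open>1 - s\<close> meets the closed neighbourhood of
      \<open>(i, s)\<close> only in column \<open>i\<close>, and that column is fully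
      coloured.\<close>
    have "\<exists>b. \<forall>j<n. \<forall>r<2. j \<noteq> i \<longrightarrow> (j, r) \<notin> B \<longrightarrow> ((j, r) \<in> U \<longleftrightarrow> b)"
      using c_eq \<open>1 - s \<noteq> s\<close> by (intro off_column[OF U[folded B_def], of _ "1 - s"]) (auto simp: B)
    then obtain b where b: "\<forall>j<n. \<forall>r<2. j \<noteq> i \<longrightarrow> (j, r) \<notin> B \<longrightarrow> ((j, r) \<in> U \<longleftrightarrow> b)" ..
    show "U = {} \<or> U = verts ?G - insert c {w. c \<rightarrow>\<^bsub>?G\<^esub> w}"
    proof (rule component_union_trivial[OF U])
      fix x assume "x \<in> verts ?G - insert c {w. c \<rightarrow>\<^bsub>?G\<^esub> w}"
      then obtain j r where "x = (j, r)" "j < n" "r < 2" "(j, r) \<notin> B"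
        unfolding verts B_def by blast
      moreover from this have "j \<noteq> i" using column by blast
      ultimately show "x \<in> U \<longleftrightarrow> b" using b by simp
    qed
  next
    fix B U
    assume B: "B \<subseteq> verts ?G" "card B \<le> 3" and U: "component_union ?G B U"
    have finB: "finite B" using B(1) unfolding verts by (rule finite_subset) simp
    define R where "R s = {j. (j, s) \<in> B}" for s
    have R: "R s \<subseteq> {..<n}" for s using B(1) unfolding R_def verts by blast
    then have finR: "finite (R s)" for s using finite_subset by blast
    have "s = 0 \<or> s = 1" if "(j, s) \<in> B" for j s
      using B(1) that unfolding verts by (auto dest!: subsetD)
    then have "B = R 0 \<times> {0} \<union> R 1 \<times> {1}"
      unfolding R_def by fast
    also have "card \<dots> = card (R 0 \<times> {0::nat}) + card (R 1 \<times> {1::nat})"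
      using finR by (intro card_Un_disjoint) auto
    finally have "card B = card (R 0) + card (R 1)"
      by (simp add: card_cartesian_product)
    \<comment> \<open>Pigeonhole: three coloured vertices in two rows leave a row with at most
      one.\<close>
    then have "\<exists>s<2. card (R s) \<le> Suc 0"
      using B(2) by (cases "card (R 0) \<le> 1") (auto intro: exI[of _ 0] exI[of _ 1])
    then obtain s where s: "s < 2" "card (R s) \<le> Suc 0" by blast
    have "\<exists>i<n. R s \<subseteq> {i}"
    proof (cases "R s = {}")
      case True
      \<comment> \<open>If the row has no coloured vertex, any column can play the part of
        \<open>i\<close>.\<close>
      then show ?thesis using n by (intro exI[of _ 0]) simp
    next
      case False
      then obtain i where "i \<in> R s" by blast
      then show ?thesis
        using R s(2) finR card_le_Suc0_iff_eq[of "R s"] by (intro exI[of _ i]) blast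
    qed
    then obtain i where i: "i < n" and row: "\<And>j. (j, s) \<in> B \<Longrightarrow> j = i"
      unfolding R_def by blast
    obtain b where "\<forall>j<n. \<forall>r<2. j \<noteq> i \<longrightarrow> (j, r) \<notin> B \<longrightarrow> ((j, r) \<in> U \<longleftrightarrow> b)"
      using off_column[OF U i s(1) row] ..
    then have b: "(j, r) \<in> U \<longleftrightarrow> b" if "j < n" "r < 2" "j \<noteq> i" "(j, r) \<notin> B" for j r
      using that by simp
    have two: "r = s \<or> r = 1 - s" if "r < 2" for r using that s(1) by auto
    have adj: "x \<in> U \<longleftrightarrow> y \<in> U" if "(i, r) = x" "x \<notin> B" "y \<notin> B" "r < 2"
      "y \<in> {(nxt i, r), (prv i, r), (i, 1 - r)}" for x y r
      using component_union_adj[OF U, of x y] nbrs[OF i \<open>r < 2\<close>] that by blast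
    let ?y = "(i, 1 - s)"
    have s': "1 - s < 2" "1 - (1 - s) = s" using s(1) by auto
    have col_s: "(i, s) \<in> U \<longleftrightarrow> b" if "(i, s) \<notin> B"
      using adj[of s "(i, s)" "(nxt i, s)"] b[of "nxt i" s] row[of "nxt i"] distinct[OF i] that s(1)
      by blast
    show "U = {} \<or> U = verts ?G - B \<or>
      (\<exists>y\<in>verts ?G. B = {w. y \<rightarrow>\<^bsub>?G\<^esub> w} \<and> (U = {y} \<or> U = verts ?G - B - {y}))"
    \<comment> \<open>Off column \<open>i\<close> all is connected, and \<open>(i, s)\<close>, if
      uncoloured, has the uncoloured row neighbour \<open>(nxt i, s)\<close>. So only
      \<open>?y\<close> can be cut off, and then all its three neighbours are coloured and make up
      \<open>B\<close>.\<close>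
    proof (cases "?y \<notin> B \<and> {w. ?y \<rightarrow>\<^bsub>?G\<^esub> w} \<subseteq> B")
      case True
      have yV: "?y \<in> verts ?G" using i s' unfolding verts by blast
      have By: "B = {w. ?y \<rightarrow>\<^bsub>?G\<^esub> w}"
        using True card_seteq[OF finB, of "{w. ?y \<rightarrow>\<^bsub>?G\<^esub> w}"] B(2) card3[OF i s'(1)] by simp
      have "(i, s) \<in> B" using By nbrs[OF i s'(1)] s'(2) by auto
      \<comment> \<open>With \<open>(i, s)\<close> coloured, \<open>?y\<close> is the only
        uncoloured vertex of column \<open>i\<close>, so \<open>U\<close> is determined by
        \<open>b\<close> and by whether it contains \<open>?y\<close>.\<close>
      then have "x \<in> U \<longleftrightarrow> b" if "x \<in> verts ?G - B - {?y}" for x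
        using that b two unfolding verts by blast
      then have "U \<in> {{}, {?y}, verts ?G - B - {?y}, verts ?G - B}"
        using U unfolding component_union_def by (cases b) blast+
      then show ?thesis using By yV by blast
    next
      case False
      have col_y: "?y \<in> U \<longleftrightarrow> b" if y: "?y \<notin> B"
      proof -
        obtain w where w: "w \<notin> B" "w \<in> {(nxt i, 1 - s), (prv i, 1 - s), (i, s)}"
          using False y nbrs[OF i s'(1)] s'(2) by auto
        then have "w \<in> U \<longleftrightarrow> b"
          using col_s b distinct[OF i] s'(1) by blast
        then show ?thesis using adj[of "1 - s" ?y w] y w s' by auto
      qed
      have "x \<in> U \<longleftrightarrow> b" if "x \<in> verts ?G - B" for x
        using that b col_s col_y two unfolding verts by blast
      then show ?thesis using component_union_trivial[OF U] by blast
    qed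
  qed (use n in \<open>simp_all add: verts card_cartesian_product\<close>)
  show ?thesis using upper lower by (rule forcing_numbers_eqI)
qed

theorem proposition4p1:
  fixes n :: nat
  shows
    "((\<forall>q. Zq q (with_proj (complete_graph n \<box> complete_graph 2)) = n) \<and>
      zero_forcing_number (with_proj (complete_graph n \<box> complete_graph 2)) = n) \<and>
     (n \<ge> 3 \<longrightarrow>
      (\<forall>q. Zq q (with_proj (path_graph n \<box> complete_graph 2)) = 2) \<and>
      zero_forcing_number (with_proj (path_graph n \<box> complete_graph 2)) = 2) \<and>
     (n \<ge> 4 \<longrightarrow>
      (\<forall>q. Zq q (with_proj (cycle_graph n \<box> complete_graph 2)) = 4) \<and>
      zero_forcing_number (with_proj (cycle_graph n \<box> complete_graph 2)) = 4)"
  using forcing_numbers_prism_complete_graph forcing_numbers_prism_path_graph[of n]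
    forcing_numbers_prism_cycle_graph[of n]
  by auto

end
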